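(* Let $m>N$ and consider the functionals $$I_N(u)=\int_\Omega\frac1{N^{N/2}}|\nabla u(x)|^N\,dx,\qquad V_N(u)=\int_\Omega\sqrt{\det\left(\nabla u(x)^T\nabla u(x)\right)}\,dx$$ for regular parameterizations $u:\Omega\subset\mathbb R^N\to\mathbb R^m$. Then $V_N$ is invariant under every invariant class $\mathcal D_0\subset\mathcal D$, and $$V_N(u)\le I_i(u)\le I_N(u),$$ where $I_i$ is the invariant realization of $I_N$ with respect to $\mathcal D_0$.
   Context: $\Omega\subset\mathbb R^N$ is a model domain such as the unit ball or the unit cube. Feasible maps $u:\Omega\to\mathbb R^m$ are smooth and regular, meaning that the $m\times N$ Jacobian matrix $\nabla u(x)$ has rank $N$ at every point; $|\cdot|$ is the Euclidean (Frobenius) norm of matrices. $\mathcal D=\mathcal D(\Omega)$ is the class of all smooth ($C^\infty$), positively oriented diffeomorphisms of $\overline\Omega$ onto itself, and $\mathcal D_{\mathrm{id}}$ is the subclass of those equal to the identity on $\partial\Omega$. An invariant class is a subclass $\mathcal D_0$ with $\mathcal D_{\mathrm{id}}\subset\mathcal D_0\subset\mathcal D$ such that $\Phi_1\circ\Phi_2\in\mathcal D_0$ whenever $\Phi_1,\Phi_2\in\mathcal D_0$. With $u_\Phi(x)=u(\Phi^{-1}(x))$, a functional $E$ is invariant under $\mathcal D_0$ if $E(u_\Phi)=E(u)$ for all feasible $u$ and all $\Phi\in\mathcal D_0$. The invariant realization of $I_N$ with respect to $\mathcal D_0$ is $I_i(u)=\inf_{\Phi\in\mathcal D_0}I_N(u_\Phi)$.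 *)

theory Defs
  imports "HOL-Analysis.Analysis"
begin

(* The unit ball and the unit cube are instances (lemmas below).  The last conjunct says that Omega
   has no slits or punctures, so that homeomorphisms of the closure preserve Omega. *)
definition model_domain :: "(real^'n) set \<Rightarrow> bool" where
  "model_domain \<Omega> \<longleftrightarrow>
     \<Omega> \<noteq> {} \<and> open \<Omega> \<and> connected \<Omega> \<and> bounded \<Omega> \<and> interior (closure \<Omega>) = \<Omega>"

lemma model_domain_convex:
  assumes "open \<Omega>" "convex \<Omega>" "bounded \<Omega>" "\<Omega> \<noteq> {}"
  shows "model_domain (\<Omega> :: (real^'n) set)"
  using assms convex_interior_closure[of \<Omega>]
  by (simp add: model_domain_def convex_connected interior_open)

lemma model_domain_ball: "model_domain (ball (0 :: real^'n) 1)"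
  by (rule model_domain_convex) auto

lemma model_domain_cube: "model_domain (box (0 :: real^'n) One)"
  by (rule model_domain_convex) (auto simp: box_ne_empty)

(* Meant for open S: f is C^k in S, expressed through iterated directional derivatives. *)
primrec Ck_on :: "nat \<Rightarrow> 'a::real_normed_vector set \<Rightarrow> ('a \<Rightarrow> 'b::real_normed_vector) \<Rightarrow> bool" where
  "Ck_on 0 S f \<longleftrightarrow> continuous_on S f"
| "Ck_on (Suc k) S f \<longleftrightarrow>
     (\<forall>x\<in>S. f differentiable (at x)) \<and> (\<forall>v. Ck_on k S (\<lambda>x. frechet_derivative f (at x) v))"

(* C-infinity on an arbitrary set S: f agrees on S with a function that is C-infinity in an open
   neighbourhood of S.  For open S this is ordinary smoothness; for the closure of a domain it is
   smoothness up to the boundary.  Values of f outside S are irrelevant. *)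
definition smooth_on :: "'a::real_normed_vector set \<Rightarrow> ('a \<Rightarrow> 'b::real_normed_vector) \<Rightarrow> bool" where
  "smooth_on S f \<longleftrightarrow>
     (\<exists>U g. open U \<and> S \<subseteq> U \<and> (\<forall>k. Ck_on k U g) \<and> (\<forall>x\<in>S. g x = f x))"

definition feasible :: "(real^'n) set \<Rightarrow> (real^'n \<Rightarrow> real^'m) \<Rightarrow> bool" where
  "feasible \<Omega> u \<longleftrightarrow> smooth_on \<Omega> u \<and> (\<forall>x\<in>\<Omega>. rank (jacobian u (at x)) = CARD('n))"

(* Maps of the closure of Omega into itself are represented by extensional functions, so that
   distinct elements are distinct maps.  Orientation is tested in Omega only: since the inverse is
   smooth up to the boundary, the Jacobian determinant does not vanish on the boundary and is
   positive there by continuity. *)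
definition diffeos :: "(real^'n) set \<Rightarrow> (real^'n \<Rightarrow> real^'n) set" where
  "diffeos \<Omega> = {\<Phi>. \<Phi> \<in> extensional (closure \<Omega>) \<and> bij_betw \<Phi> (closure \<Omega>) (closure \<Omega>) \<and>
     smooth_on (closure \<Omega>) \<Phi> \<and> smooth_on (closure \<Omega>) (inv_into (closure \<Omega>) \<Phi>) \<and>
     (\<forall>x\<in>\<Omega>. det (jacobian \<Phi> (at x)) > 0)}"

definition diffeos_id :: "(real^'n) set \<Rightarrow> (real^'n \<Rightarrow> real^'n) set" where
  "diffeos_id \<Omega> = {\<Phi> \<in> diffeos \<Omega>. \<forall>x\<in>frontier \<Omega>. \<Phi> x = x}"

definition invariant_class :: "(real^'n) set \<Rightarrow> (real^'n \<Rightarrow> real^'n) set \<Rightarrow> bool" where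
  "invariant_class \<Omega> D0 \<longleftrightarrow> diffeos_id \<Omega> \<subseteq> D0 \<and> D0 \<subseteq> diffeos \<Omega> \<and>
     (\<forall>\<Phi>1\<in>D0. \<forall>\<Phi>2\<in>D0. compose (closure \<Omega>) \<Phi>1 \<Phi>2 \<in> D0)"

definition reparam :: "(real^'n) set \<Rightarrow> (real^'n \<Rightarrow> real^'n) \<Rightarrow> (real^'n \<Rightarrow> real^'m) \<Rightarrow> (real^'n \<Rightarrow> real^'m)" where
  "reparam \<Omega> \<Phi> u = (\<lambda>x. u (inv_into (closure \<Omega>) \<Phi> x))"

definition invariant_under ::
  "(real^'n) set \<Rightarrow> (real^'n \<Rightarrow> real^'n) set \<Rightarrow> ((real^'n \<Rightarrow> real^'m) \<Rightarrow> ennreal) \<Rightarrow> bool" where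
  "invariant_under \<Omega> D0 E \<longleftrightarrow> (\<forall>u \<Phi>. feasible \<Omega> u \<longrightarrow> \<Phi> \<in> D0 \<longrightarrow> E (reparam \<Omega> \<Phi> u) = E u)"

(* The functionals take values in the extended nonnegative reals: a feasible map is only required
   to be smooth in the open set Omega, so the integrals may be infinite.  On real^'n^'m the library
   norm is the Frobenius norm. *)
definition I_N :: "(real^'n) set \<Rightarrow> (real^'n \<Rightarrow> real^'m) \<Rightarrow> ennreal" where
  "I_N \<Omega> u = (\<integral>\<^sup>+x\<in>\<Omega>. ennreal (1 / real CARD('n) powr (real CARD('n) / 2)
                              * norm (jacobian u (at x)) ^ CARD('n)) \<partial>lborel)"

definition V_N :: "(real^'n) set \<Rightarrow> (real^'n \<Rightarrow> real^'m) \<Rightarrow> ennreal" where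
  "V_N \<Omega> u = (\<integral>\<^sup>+x\<in>\<Omega>. ennreal (sqrt (det (transpose (jacobian u (at x)) ** jacobian u (at x))))
                \<partial>lborel)"

definition invariant_realization ::
  "(real^'n) set \<Rightarrow> (real^'n \<Rightarrow> real^'n) set \<Rightarrow> ((real^'n \<Rightarrow> real^'m) \<Rightarrow> ennreal)
     \<Rightarrow> (real^'n \<Rightarrow> real^'m) \<Rightarrow> ennreal" where
  "invariant_realization \<Omega> D0 E u = (INF \<Phi>\<in>D0. E (reparam \<Omega> \<Phi> u))"

end

theory Submission
  imports Defs
begin

text \<open>
  Two facts carry the result. The first is pointwise: for a matrix $A$ with $n$ columns,
  $\sqrt{\det (A^T A)} \le n^{-n/2} |A|^n$. Indeed, $A^T A$ is the Gram matrix of the columns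
  $a_1, \dots, a_n$ of $A$; Hadamard's inequality bounds its determinant by $\prod_k |a_k|^2$, and
  the inequality of arithmetic and geometric means bounds this product by
  $(\sum_k |a_k|^2 / n)^n = (|A|^2/n)^n$. Integration gives $V_N(u) \le I_N(u)$
  (\<open>volume_density_le_energy_density\<close>, \<open>V_N_le_I_N\<close>).

  The second fact is the invariance $V_N(u_\Phi) = V_N(u)$ (\<open>V_N_reparam\<close>). With
  $\Psi = \Phi^{-1}$, the chain rule turns the Gram determinant of $\nabla u_\Phi$ at $x$ into
  $(\det \nabla\Psi(x))^2$ times that of $\nabla u$ at $\Psi(x)$. The square root produces exactly the
  factor $|\det \nabla\Psi(x)|$ of the change of variables $y = \Psi(x)$. By invariance of domain,
  $\Psi$ maps the open set $\Omega$, and not only its closure, onto itself. Since a feasible map may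
  have infinite volume, the change of variables has to hold for integrals with values in
  $[0,\infty]$ (\<open>nn_integral_change_of_variables\<close>).

  Together these give $V_N(u) = V_N(u_\Phi) \le I_N(u_\Phi)$ for every $\Phi \in \mathcal D_0$, hence the
  bound $V_N(u) \le I_i(u)$ for the infimum. The bound $I_i(u) \le I_N(u)$ holds because the identity of
  the closure lies in $\mathcal D_{\mathrm{id}} \subset \mathcal D_0$.
\<close>

section \<open>Hadamard's inequality and the pointwise comparison\<close>

text \<open>
  The second family \<open>b\<close> is independent of \<open>a\<close> so that the row operation can be used twice, once for
  the rows and, after transposition, once for the columns of a Gram matrix.
\<close>

lemma det_gram_row_update:
  fixes a b :: "'n::finite \<Rightarrow> 'v::real_inner"
  assumes "i \<notin> S"
  shows "det (\<chi> k l. (a(i := a i + (\<Sum>j\<in>S. c j *\<^sub>R a j))) k \<bullet> b l) = det (\<chi> k l. a k \<bullet> b l)"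
proof -
  let ?G = "\<chi> k l. a k \<bullet> b l"
  let ?x = "\<Sum>j\<in>S. c j *s row j ?G"
  have "?x \<in> vec.span {row j ?G | j. j \<noteq> i}"
    using assms by (intro vec.span_sum vec.span_scale vec.span_base) auto
  then have "det (\<chi> k. if k = i then row i ?G + ?x else row k ?G) = det ?G"
    by (rule det_row_span)
  moreover have "(\<chi> k. if k = i then row i ?G + ?x else row k ?G) =
      (\<chi> k l. (a(i := a i + (\<Sum>j\<in>S. c j *\<^sub>R a j))) k \<bullet> b l)"
    by (simp add: vec_eq_iff row_def inner_left_distrib inner_sum_left)
  ultimately show ?thesis
    by simp
qed

lemma det_gram_update:
  fixes a :: "'n::finite \<Rightarrow> 'v::real_inner" and c :: "'n \<Rightarrow> real"
  assumes "i \<notin> S"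
  defines "a' \<equiv> a(i := a i + (\<Sum>j\<in>S. c j *\<^sub>R a j))"
  shows "det (\<chi> k l. a' k \<bullet> a' l) = det (\<chi> k l. a k \<bullet> a l)"
proof -
  have "det (\<chi> k l. a' k \<bullet> a' l) = det (\<chi> k l. a k \<bullet> a' l)"
    unfolding a'_def by (rule det_gram_row_update[OF assms(1)])
  also have "\<dots> = det (\<chi> k l. a' k \<bullet> a l)"
    by (subst det_transpose[symmetric]) (simp add: transpose_def inner_commute)
  also have "\<dots> = det (\<chi> k l. a k \<bullet> a l)"
    unfolding a'_def by (rule det_gram_row_update[OF assms(1)])
  finally show ?thesis .
qed

text \<open>
  Gram-Schmidt orthogonalization without normalization: subtracting from a vector its projection
  onto the span of other members of the family is a shear, which leaves the Gram determinant
  unchanged, and it does not lengthen the vector.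
\<close>

lemma orthogonalize_preserving_det_gram:
  fixes a :: "'n::finite \<Rightarrow> 'v::real_inner" and S :: "'n set"
  shows "\<exists>b :: 'n \<Rightarrow> 'v. det (\<chi> k l. b k \<bullet> b l) = det (\<chi> k l. a k \<bullet> a l) \<and>
    (\<forall>k. b k \<bullet> b k \<le> a k \<bullet> a k) \<and> (\<forall>k\<in>S. \<forall>l\<in>S. k \<noteq> l \<longrightarrow> b k \<bullet> b l = 0)"
  using finite[of S]
proof (induction S rule: finite_induct)
  case empty
  show ?case by (rule exI[of _ a]) simp
next
  case (insert i S)
  obtain b :: "'n \<Rightarrow> 'v" where b: "det (\<chi> k l. b k \<bullet> b l) = det (\<chi> k l. a k \<bullet> a l)"
      "\<And>k. b k \<bullet> b k \<le> a k \<bullet> a k"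
      "\<And>k l. k \<in> S \<Longrightarrow> l \<in> S \<Longrightarrow> k \<noteq> l \<Longrightarrow> b k \<bullet> b l = 0"
    using insert.IH by blast
  \<comment> \<open>if \<open>b j = 0\<close>, division by zero gives the coefficient 0, as desired\<close>
  define c where "c j = - ((b i \<bullet> b j) / (b j \<bullet> b j))" for j
  define p where "p = (\<Sum>j\<in>S. c j *\<^sub>R b j)"
  define r where "r = b i + p"
  have orth: "r \<bullet> b k = 0" if "k \<in> S" for k
  proof -
    have "p \<bullet> b k = (\<Sum>j\<in>S. if j = k then c k * (b k \<bullet> b k) else 0)"
      unfolding p_def inner_sum_left using b(3) that by (intro sum.cong) auto
    also have "\<dots> = c k * (b k \<bullet> b k)"
      using insert.hyps that by simp
    finally show ?thesis
      by (simp add: r_def inner_left_distrib c_def)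
  qed
  have "r \<bullet> p = 0"
    unfolding p_def inner_sum_right using orth by simp
  moreover have "b i = r - p"
    by (simp add: r_def)
  ultimately have "b i \<bullet> b i = r \<bullet> r + p \<bullet> p"
    by (simp add: inner_diff inner_commute)
  then have "r \<bullet> r \<le> a i \<bullet> a i"
    using b(2)[of i] inner_ge_zero[of p] by linarith
  moreover have "det (\<chi> k l. (b(i := r)) k \<bullet> (b(i := r)) l) = det (\<chi> k l. a k \<bullet> a l)"
    using det_gram_update[OF insert.hyps(2), of b c] b(1) by (simp add: r_def p_def)
  moreover have "(b(i := r)) k \<bullet> (b(i := r)) l = 0"
    if "k \<in> insert i S" "l \<in> insert i S" "k \<noteq> l" for k l
    using that b(3)[of k l] orth[of k] orth[of l] by (auto simp: inner_commute split: if_splits)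
  ultimately show ?case
    using b(2) by (intro exI[of _ "b(i := r)"]) simp
qed

text \<open>
  The upper bound is Hadamard's inequality. For an orthogonal family the Gram matrix is diagonal
  and both claims are evident; orthogonalization reduces the general case to this one, since the
  determinant is preserved and no diagonal entry grows.
\<close>

lemma det_gram_bounds:
  fixes a :: "'n::finite \<Rightarrow> 'v::real_inner"
  shows det_gram_nonneg: "0 \<le> det (\<chi> k l. a k \<bullet> a l)"
    and det_gram_le_prod: "det (\<chi> k l. a k \<bullet> a l) \<le> (\<Prod>k\<in>UNIV. a k \<bullet> a k)"
proof -
  obtain b :: "'n \<Rightarrow> 'v" where b: "det (\<chi> k l. b k \<bullet> b l) = det (\<chi> k l. a k \<bullet> a l)"
      "\<And>k. b k \<bullet> b k \<le> a k \<bullet> a k" "\<And>k l. k \<noteq> l \<Longrightarrow> b k \<bullet> b l = 0"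
    using orthogonalize_preserving_det_gram[of a UNIV] by blast
  have eq: "det (\<chi> k l. a k \<bullet> a l) = (\<Prod>k\<in>UNIV. b k \<bullet> b k)"
    unfolding b(1)[symmetric] using b(3) by (subst det_diagonal) auto
  show "0 \<le> det (\<chi> k l. a k \<bullet> a l)"
    unfolding eq by (intro prod_nonneg) auto
  show "det (\<chi> k l. a k \<bullet> a l) \<le> (\<Prod>k\<in>UNIV. a k \<bullet> a k)"
    unfolding eq using b(2) by (intro prod_mono) auto
qed

lemma gram_matrix_columns:
  fixes A :: "real^'n^'m"
  shows "transpose A ** A = (\<chi> k l. column k A \<bullet> column l A)"
  by (simp add: vec_eq_iff matrix_matrix_mult_def transpose_def column_def inner_vec_def)

lemma norm_matrix_eq_sum_columns:
  fixes A :: "real^'n^'m"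
  shows "(norm A)\<^sup>2 = (\<Sum>k\<in>UNIV. column k A \<bullet> column k A)"
proof -
  have "(norm A)\<^sup>2 = (\<Sum>i\<in>UNIV. \<Sum>k\<in>UNIV. A $ i $ k * A $ i $ k)"
    by (simp add: power2_norm_eq_inner inner_vec_def)
  also have "\<dots> = (\<Sum>k\<in>UNIV. column k A \<bullet> column k A)"
    by (subst sum.swap) (simp add: inner_vec_def column_def)
  finally show ?thesis .
qed

lemma root_powr:
  fixes P :: real
  assumes "0 < n" "0 \<le> P"
  shows "(P powr (1 / real n)) ^ n = P"
  using assms by (cases "P = 0") (simp_all add: powr_powr flip: powr_realpow)

text \<open>
  Hadamard's inequality for the columns of \<open>A\<close>, followed by the inequality of arithmetic and
  geometric means for their squared lengths, which sum to the squared Frobenius norm.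
\<close>

lemma volume_density_le_energy_density:
  fixes A :: "real^'n^'m"
  shows "sqrt (det (transpose A ** A))
    \<le> 1 / real CARD('n) powr (real CARD('n) / 2) * norm A ^ CARD('n)"
proof -
  let ?n = "CARD('n)" and ?P = "\<Prod>k\<in>UNIV. column k A \<bullet> column k A"
  have P0: "0 \<le> ?P"
    by (intro prod_nonneg) auto
  have "?P powr (1 / ?n) \<le> (\<Sum>k\<in>UNIV. column k A \<bullet> column k A / ?n)"
    by (rule arith_geom_mean) auto
  also have "\<dots> = (norm A)\<^sup>2 / ?n"
    by (simp add: norm_matrix_eq_sum_columns sum_divide_distrib)
  finally have "(?P powr (1 / ?n)) ^ ?n \<le> ((norm A)\<^sup>2 / ?n) ^ ?n"
    by (intro power_mono) auto
  moreover have "(?P powr (1 / ?n)) ^ ?n = ?P"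
    using root_powr[OF _ P0, of ?n] by simp
  ultimately have "det (transpose A ** A) \<le> ((norm A)\<^sup>2 / ?n) ^ ?n"
    unfolding gram_matrix_columns using det_gram_le_prod[of "\<lambda>k. column k A"] by simp
  also have "\<dots> = (1 / real ?n powr (real ?n / 2) * norm A ^ ?n)\<^sup>2"
  proof -
    have "(real ?n powr (real ?n / 2))\<^sup>2 = real ?n ^ ?n"
      by (simp add: powr_power powr_realpow)
    then show ?thesis
      by (simp add: power_mult_distrib power_divide power_even_eq flip: power_mult)
  qed
  finally show ?thesis
    by (intro real_le_lsqrt) auto
qed

section \<open>Change of variables for nonnegative integrals\<close>

text \<open>
  In the Leibniz formula, conjugation by \<open>\<pi>\<close> matches the permutations of the two index types and
  preserves their signs.
\<close>

lemma det_reindex: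
  fixes A :: "'a::comm_ring_1^'k^'k" and \<pi> :: "'n::finite \<Rightarrow> 'k::finite"
  assumes "bij \<pi>"
  shows "det (\<chi> i j. A $ \<pi> i $ \<pi> j) = det A"
proof -
  let ?M = "map_permutation UNIV \<pi>" and ?W = "map_permutation UNIV (inv \<pi>)"
  have bij: "bij_betw \<pi> UNIV UNIV" "bij_betw (inv \<pi>) UNIV UNIV"
    using assms by (simp_all add: bij_imp_bij_inv)
  have inv: "inv \<pi> (\<pi> i) = i" "\<pi> (inv \<pi> k) = k" for i k
    using assms by (simp_all add: bij_is_inj bij_is_surj surj_f_inv_f)
  have M: "?M p (\<pi> i) = \<pi> (p i)" for p i
    using assms by (simp add: map_permutation_apply bij_is_inj)
  show ?thesis
    unfolding det_def
  proof (rule sum.reindex_bij_witness[where i = ?W and j = ?M])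
    fix p :: "'n \<Rightarrow> 'n" assume p: "p \<in> {p. p permutes UNIV}"
    show "?W (?M p) = p"
      using p by (intro map_permutation_compose_inv[OF bij(1)]) (auto simp: inv)
    show "?M p \<in> {p. p permutes UNIV}"
      using p bij by (auto intro: map_permutation_permutes)
    have "sign (?M p) = sign p"
      using p assms by (intro sign_map_permutation) (auto simp: bij_is_inj)
    moreover have "(\<Prod>k\<in>UNIV. A $ k $ ?M p k) = (\<Prod>i\<in>UNIV. A $ \<pi> i $ \<pi> (p i))"
      using prod.reindex_bij_betw[OF bij(1), of "\<lambda>k. A $ k $ ?M p k"] by (simp add: M)
    ultimately show "of_int (sign (?M p)) * (\<Prod>k\<in>UNIV. A $ k $ ?M p k) =
        of_int (sign p) * (\<Prod>i\<in>UNIV. (\<chi> i j. A $ \<pi> i $ \<pi> j) $ i $ p i)"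
      by simp
  next
    fix q :: "'k \<Rightarrow> 'k" assume q: "q \<in> {p. p permutes UNIV}"
    show "?M (?W q) = q"
      using q by (intro map_permutation_compose_inv[OF bij(2)]) (auto simp: inv)
    show "?W q \<in> {p. p permutes UNIV}"
      using q bij by (auto intro: map_permutation_permutes)
  qed
qed

text \<open>
  A change of variables that transfers absolute integrability in both directions, together with
  the value of the integral, yields one for integrals in $[0,\infty]$: by this lemma, the two
  nonnegative integrals take the same finite values, hence are infinite together.
\<close>

lemma absolutely_integrable_iff_set_nn_integral:
  fixes h :: "'a::euclidean_space \<Rightarrow> real"
  assumes h: "\<And>x. x \<in> T \<Longrightarrow> 0 \<le> h x" and m: "set_borel_measurable borel T h" and "0 \<le> r"
  shows "h absolutely_integrable_on T \<and> integral T h = r \<longleftrightarrow>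
    (\<integral>\<^sup>+x\<in>T. ennreal (h x) \<partial>lborel) = ennreal r"
proof -
  let ?f = "\<lambda>x. if x \<in> T then h x else 0"
  have f: "?f = (\<lambda>x. indicator T x *\<^sub>R h x)"
    by auto
  have "?f \<in> borel_measurable lebesgue"
    using m unfolding f set_borel_measurable_def by (simp add: measurable_completion)
  moreover have "integral\<^sup>N lebesgue ?f = (\<integral>\<^sup>+x\<in>T. ennreal (h x) \<partial>lborel)"
    unfolding nn_integral_completion by (intro nn_integral_cong) auto
  moreover have "0 \<le> ?f x" for x
    using h by simp
  ultimately have "(?f has_integral r) UNIV \<longleftrightarrow> (\<integral>\<^sup>+x\<in>T. ennreal (h x) \<partial>lborel) = ennreal r"
    using has_integral_iff_nn_integral_lebesgue[of ?f r] \<open>0 \<le> r\<close> by simp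
  moreover have "h absolutely_integrable_on T \<longleftrightarrow> h integrable_on T"
    using nonnegative_absolutely_integrable_1[of h T] h unfolding absolutely_integrable_on_def by argo
  ultimately show ?thesis
    by (simp only: has_integral_restrict_UNIV) (simp only: has_integral_iff)
qed

lemma nn_integral_change_of_variables_wellorder:
  fixes S :: "(real^'n::{finite,wellorder}) set" and f :: "real^'n::{finite,wellorder} \<Rightarrow> real"
  assumes S: "S \<in> sets borel"
    and g': "\<And>x. x \<in> S \<Longrightarrow> (g has_derivative g' x) (at x within S)" and inj: "inj_on g S"
    and f: "\<And>y. y \<in> g ` S \<Longrightarrow> 0 \<le> f y"
    and m: "set_borel_measurable borel S (\<lambda>x. \<bar>det (matrix (g' x))\<bar> * f (g x))"
      "set_borel_measurable borel (g ` S) f"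
  shows "(\<integral>\<^sup>+x\<in>S. ennreal (\<bar>det (matrix (g' x))\<bar> * f (g x)) \<partial>lborel) =
    (\<integral>\<^sup>+y\<in>g ` S. ennreal (f y) \<partial>lborel)" (is "?A = ?B")
proof -
  let ?h = "\<lambda>x. \<bar>det (matrix (g' x))\<bar> * f (g x)"
  have "S \<in> sets lebesgue"
    using S by simp
  note cov = has_absolute_integral_change_of_variables[OF this g' inj,
      of "\<lambda>y. vec (f y) :: real^1"]
  \<comment> \<open>real integrands are regarded as functions with values in \<open>real^1\<close>\<close>
  have cov1: "?h absolutely_integrable_on S \<and> integral S ?h = r \<longleftrightarrow>
      f absolutely_integrable_on (g ` S) \<and> integral (g ` S) f = r" for r
    using cov[of "vec r"]
    by (simp add: absolutely_integrable_on_1_iff integral_on_1_eq)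
  have eq_iff: "?A = ennreal r \<longleftrightarrow> ?B = ennreal r" if "0 \<le> r" for r
  proof -
    have "?A = ennreal r \<longleftrightarrow> ?h absolutely_integrable_on S \<and> integral S ?h = r"
      by (rule absolutely_integrable_iff_set_nn_integral[OF _ m(1) that, symmetric]) (simp add: f)
    also have "\<dots> \<longleftrightarrow> f absolutely_integrable_on (g ` S) \<and> integral (g ` S) f = r"
      by (rule cov1)
    also have "\<dots> \<longleftrightarrow> ?B = ennreal r"
      by (rule absolutely_integrable_iff_set_nn_integral[OF f m(2) that])
    finally show ?thesis .
  qed
  show ?thesis
  proof (cases ?A rule: ennreal_cases)
    case (real r)
    with eq_iff[of r] show ?thesis
      by argo
  next
    case top
    then have "?B \<noteq> ennreal r" if "0 \<le> r" for r
      using eq_iff[OF that] ennreal_neq_top by metis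
    then have "?B = top"
      by (meson ennreal_cases)
    with top show ?thesis
      by argo
  qed
qed

text \<open>
  The preceding lemma needs coordinates indexed by a well-ordered type. Any finite
  index type can be well-ordered through an injection into the natural numbers. The order is put on
  a copy of the type, because the type may already carry a different one. Relabelling
  coordinates preserves both Lebesgue measure and determinants, so the formula carries over.
\<close>

datatype 'n ordered = Ordered (original: 'n)

lemma all_ordered_iff: "(\<forall>k. P k) \<longleftrightarrow> (\<forall>i. P (Ordered i))"
  by (metis ordered.exhaust)

lemma bij_Ordered: "bij Ordered"
  by (rule bij_betw_byWitness[where f' = original]) auto

lemma bij_original: "bij original"
  by (rule bij_betw_byWitness[where f' = Ordered]) auto

instance ordered :: (finite) finite
  by standard (use bij_Ordered in \<open>metis bij_betw_finite finite_class.finite_UNIV\<close>)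

definition position :: "'n::finite ordered \<Rightarrow> nat" where
  "position = (SOME f. inj f)"

lemma inj_position: "inj (position :: 'n::finite ordered \<Rightarrow> nat)"
proof -
  have "\<exists>f :: 'n ordered \<Rightarrow> nat. inj f"
    using finite_imp_inj_to_nat_seg[OF finite_class.finite_UNIV] by blast
  then show ?thesis
    unfolding position_def by (rule someI_ex)
qed

instantiation ordered :: (finite) wellorder
begin

definition less_eq_ordered :: "'a ordered \<Rightarrow> 'a ordered \<Rightarrow> bool" where
  "x \<le> y \<longleftrightarrow> position x \<le> position y"

definition less_ordered :: "'a ordered \<Rightarrow> 'a ordered \<Rightarrow> bool" where
  "x < y \<longleftrightarrow> position x < position y"

instance
proof
  fix P :: "'a ordered \<Rightarrow> bool" and a
  assume "\<And>x. (\<And>y. y < x \<Longrightarrow> P y) \<Longrightarrow> P x"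
  then show "P a"
    unfolding less_ordered_def by (induction a rule: measure_induct_rule[of position]) blast
qed (auto simp: less_eq_ordered_def less_ordered_def dest: injD[OF inj_position])

end

definition to_ordered :: "real^'n \<Rightarrow> real^'n ordered" where
  "to_ordered x = (\<chi> k. x $ original k)"

definition of_ordered :: "real^'n ordered \<Rightarrow> real^'n" where
  "of_ordered y = (\<chi> i. y $ Ordered i)"

lemma of_to_ordered [simp]: "of_ordered (to_ordered x) = x"
  by (simp add: of_ordered_def to_ordered_def vec_eq_iff)

lemma to_of_ordered [simp]: "to_ordered (of_ordered y) = y"
  by (simp add: of_ordered_def to_ordered_def vec_eq_iff)

lemma linear_to_ordered: "linear to_ordered"
  by (simp add: linear_iff to_ordered_def vec_eq_iff)

lemma linear_of_ordered: "linear of_ordered"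
  by (simp add: linear_iff of_ordered_def vec_eq_iff)

lemma to_ordered_image: "to_ordered ` S = of_ordered -` S"
proof -
  have "y \<in> to_ordered ` S" if "of_ordered y \<in> S" for y
    using that by (metis image_eqI to_of_ordered)
  then show ?thesis
    by auto
qed

lemma det_to_ordered:
  fixes f :: "real^'n \<Rightarrow> real^'n"
  shows "det (matrix (to_ordered \<circ> f \<circ> of_ordered)) = det (matrix f)"
proof -
  have "of_ordered (axis k 1) = axis (original k) 1" for k :: "'n ordered"
    by (cases k) (auto simp: of_ordered_def axis_def vec_eq_iff)
  then have "matrix (to_ordered \<circ> f \<circ> of_ordered) =
      (\<chi> k l. matrix f $ original k $ original l)"
    unfolding matrix_def to_ordered_def by simp
  then show ?thesis
    by (simp add: det_reindex bij_original)
qed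

lemma borel_measurable_of_ordered [measurable]: "of_ordered \<in> borel_measurable borel"
  using linear_of_ordered by (intro borel_measurable_continuous_onI linear_continuous_on)
    (simp add: linear_conv_bounded_linear)

text \<open>
  Relabelling maps boxes to boxes with the same side lengths.
\<close>

lemma distr_of_ordered: "distr lborel borel of_ordered = (lborel :: (real^'n) measure)"
proof (rule lborel_eqI[symmetric])
  fix l u :: "real^'n"
  assume lu: "\<And>b. b \<in> Basis \<Longrightarrow> l \<bullet> b \<le> u \<bullet> b"
  have le: "l $ i \<le> u $ i" for i
    using lu[of "axis i 1"] by (simp add: axis_in_Basis_iff cart_eq_inner_axis)
  have le': "to_ordered l \<bullet> b \<le> to_ordered u \<bullet> b" if "b \<in> Basis" for b
    using that le by (auto simp: Basis_vec_def inner_axis to_ordered_def)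
  have vimage: "of_ordered -` box l u = box (to_ordered l) (to_ordered u)"
    by (auto simp: mem_box_cart of_ordered_def to_ordered_def all_ordered_iff)
  have basis: "(\<Prod>b\<in>Basis. (v - w) \<bullet> b) = (\<Prod>i\<in>UNIV. v $ i - w $ i)" for v w :: "real^'k"
    by (simp add: Basis_vec_def prod.UNION_disjoint axis_eq_axis inner_axis)
  have "emeasure (distr lborel borel of_ordered) (box l u) =
      emeasure lborel (box (to_ordered l) (to_ordered u))"
    by (subst emeasure_distr) (auto simp: vimage)
  also have "\<dots> = (\<Prod>b\<in>Basis. (to_ordered u - to_ordered l) \<bullet> b)"
    using le' by (simp add: emeasure_lborel_box)
  also have "(\<Prod>b\<in>Basis. (to_ordered u - to_ordered l) \<bullet> b) = (\<Prod>b\<in>Basis. (u - l) \<bullet> b)"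
    unfolding basis to_ordered_def
    using prod.reindex_bij_betw[OF bij_original, of "\<lambda>i. u $ i - l $ i"] by simp
  finally show "emeasure (distr lborel borel of_ordered) (box l u) = (\<Prod>b\<in>Basis. (u - l) \<bullet> b)" .
qed simp

lemma nn_integral_of_ordered:
  fixes F :: "real^'n \<Rightarrow> ennreal"
  assumes "F \<in> borel_measurable borel"
  shows "(\<integral>\<^sup>+y. F (of_ordered y) \<partial>lborel) = (\<integral>\<^sup>+x. F x \<partial>lborel)"
  by (subst (2) distr_of_ordered[symmetric]) (use assms in \<open>simp add: nn_integral_distr\<close>)

lemma set_nn_integral_of_ordered:
  fixes h :: "real^'n \<Rightarrow> real"
  assumes "set_borel_measurable borel T h"
  shows "(\<integral>\<^sup>+y\<in>to_ordered ` T. ennreal (h (of_ordered y)) \<partial>lborel) = (\<integral>\<^sup>+x\<in>T. ennreal (h x) \<partial>lborel)"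
proof -
  have eq: "ennreal (h x) * indicator T x = ennreal (indicator T x *\<^sub>R h x)" for x
    by (simp add: indicator_def)
  have "(\<lambda>x. ennreal (h x) * indicator T x) \<in> borel_measurable borel"
    unfolding eq using assms by (simp add: set_borel_measurable_def)
  from nn_integral_of_ordered[OF this] show ?thesis
    by (simp add: to_ordered_image indicator_vimage)
qed

lemma set_borel_measurable_of_ordered:
  assumes "set_borel_measurable borel T h"
  shows "set_borel_measurable borel (to_ordered ` T) (\<lambda>y. h (of_ordered y))"
  using measurable_compose[OF borel_measurable_of_ordered assms[unfolded set_borel_measurable_def]]
  by (simp add: set_borel_measurable_def to_ordered_image indicator_vimage)

text \<open>
  Conjugating \<open>g\<close> by the relabelling of coordinates reduces the claim to a well-ordered index type.
\<close>

lemma nn_integral_change_of_variables: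
  fixes S :: "(real^'n) set" and f :: "real^'n \<Rightarrow> real"
  assumes S: "S \<in> sets borel"
    and g': "\<And>x. x \<in> S \<Longrightarrow> (g has_derivative g' x) (at x within S)" and inj: "inj_on g S"
    and f: "\<And>y. y \<in> g ` S \<Longrightarrow> 0 \<le> f y"
    and m: "set_borel_measurable borel S (\<lambda>x. \<bar>det (matrix (g' x))\<bar> * f (g x))"
      "set_borel_measurable borel (g ` S) f"
  shows "(\<integral>\<^sup>+x\<in>S. ennreal (\<bar>det (matrix (g' x))\<bar> * f (g x)) \<partial>lborel) =
    (\<integral>\<^sup>+y\<in>g ` S. ennreal (f y) \<partial>lborel)"
proof -
  let ?S = "to_ordered ` S" and ?g = "to_ordered \<circ> g \<circ> of_ordered"
  let ?g' = "\<lambda>y. to_ordered \<circ> g' (of_ordered y) \<circ> of_ordered"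
  let ?h = "\<lambda>x. \<bar>det (matrix (g' x))\<bar> * f (g x)"
  have image: "?g ` ?S = to_ordered ` g ` S"
    by (simp add: image_image)
  have det: "det (matrix (?g' y)) = det (matrix (g' (of_ordered y)))" for y
    by (rule det_to_ordered)
  have "(\<integral>\<^sup>+x\<in>S. ennreal (?h x) \<partial>lborel) = (\<integral>\<^sup>+y\<in>?S. ennreal (?h (of_ordered y)) \<partial>lborel)"
    by (rule set_nn_integral_of_ordered[OF m(1), symmetric])
  also have "\<dots> = (\<integral>\<^sup>+y\<in>?S. ennreal (\<bar>det (matrix (?g' y))\<bar> * f (of_ordered (?g y))) \<partial>lborel)"
    by (intro nn_integral_cong) (auto simp: det split: split_indicator)
  also have "\<dots> = (\<integral>\<^sup>+z\<in>?g ` ?S. ennreal (f (of_ordered z)) \<partial>lborel)"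
  proof (rule nn_integral_change_of_variables_wellorder)
    show "?S \<in> sets borel"
      unfolding to_ordered_image using measurable_sets[OF borel_measurable_of_ordered S] by simp
    show "(?g has_derivative ?g' y) (at y within ?S)" if "y \<in> ?S" for y
    proof (intro diff_chain_within linear_imp_has_derivative)
      show "linear of_ordered" "linear to_ordered"
        by (rule linear_of_ordered linear_to_ordered)+
      show "(g has_derivative g' (of_ordered y)) (at (of_ordered y) within of_ordered ` ?S)"
        using that g' by (auto simp: image_image)
    qed
    show "inj_on ?g ?S"
      using inj by (simp add: inj_on_def) (metis of_to_ordered)
    show "0 \<le> f (of_ordered z)" if "z \<in> ?g ` ?S" for z
      using that f by auto
    have "set_borel_measurable borel ?S (\<lambda>y. \<bar>det (matrix (?g' y))\<bar> * f (of_ordered (?g y)))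
        \<longleftrightarrow> set_borel_measurable borel ?S (\<lambda>y. ?h (of_ordered y))"
      unfolding set_borel_measurable_def
      by (intro measurable_cong) (auto simp: det split: split_indicator)
    then show "set_borel_measurable borel ?S
        (\<lambda>y. \<bar>det (matrix (?g' y))\<bar> * f (of_ordered (?g y)))"
      using set_borel_measurable_of_ordered[OF m(1)] by simp
    show "set_borel_measurable borel (?g ` ?S) (\<lambda>z. f (of_ordered z))"
      unfolding image by (rule set_borel_measurable_of_ordered[OF m(2)])
  qed
  also have "\<dots> = (\<integral>\<^sup>+y\<in>g ` S. ennreal (f y) \<partial>lborel)"
    unfolding image by (rule set_nn_integral_of_ordered[OF m(2)])
  finally show ?thesis .
qed

section \<open>Jacobians of smooth maps\<close>

lemma jacobian_eqI:
  fixes A :: "real^'n^'m"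
  assumes "(f has_derivative (\<lambda>h. A *v h)) (at x)"
  shows "jacobian f (at x) = A"
  unfolding jacobian_def frechet_derivative_at[OF assms, symmetric]
  by (rule matrix_of_matrix_vector_mul)

lemma jacobian_cong_open:
  assumes "open S" "x \<in> S" "\<And>y. y \<in> S \<Longrightarrow> f y = g y"
  shows "jacobian f (at x) = jacobian g (at x)"
proof -
  have "(f has_derivative D) (at x) \<longleftrightarrow> (g has_derivative D) (at x)" for D
    using has_derivative_transform_within_open[OF _ assms(1,2)] assms(3) by metis
  then show ?thesis
    by (simp add: jacobian_def frechet_derivative_def)
qed

lemma smooth_on_subset: "smooth_on S f \<Longrightarrow> T \<subseteq> S \<Longrightarrow> smooth_on T f"
  unfolding smooth_on_def by blast

lemma smooth_on_imp_continuous_on: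
  assumes "smooth_on S f"
  shows "continuous_on S f"
proof -
  obtain U g where g: "S \<subseteq> U" "\<forall>k. Ck_on k U g" "\<forall>x\<in>S. g x = f x"
    using assms unfolding smooth_on_def by blast
  have "continuous_on U g"
    using spec[OF g(2), of 0] by simp
  then show ?thesis
    using g by (metis continuous_on_cong continuous_on_subset)
qed

text \<open>
  On an open set, the Jacobian of \<open>f\<close> agrees with that of a smooth local extension, which is
  continuous because its directional derivatives are.
\<close>

lemma
  fixes f :: "real^'n \<Rightarrow> real^'m"
  assumes "open S" "smooth_on S f"
  shows smooth_on_imp_has_derivative_jacobian:
      "\<And>x. x \<in> S \<Longrightarrow> (f has_derivative (\<lambda>h. jacobian f (at x) *v h)) (at x)"
    and smooth_on_imp_continuous_on_jacobian: "continuous_on S (\<lambda>x. jacobian f (at x))"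
proof -
  obtain U g where g: "open U" "S \<subseteq> U" "\<forall>k. Ck_on k U g" "\<And>x. x \<in> S \<Longrightarrow> g x = f x"
    using assms(2) unfolding smooth_on_def by blast
  have C1: "g differentiable (at x)" "continuous_on U (\<lambda>x. frechet_derivative g (at x) v)"
    if "x \<in> U" for x v
    using spec[OF g(3), of 1] that by auto
  have J: "jacobian f (at x) = jacobian g (at x)" if "x \<in> S" for x
    using jacobian_cong_open[OF assms(1) that] g(4) by metis
  show "(f has_derivative (\<lambda>h. jacobian f (at x) *v h)) (at x)" if "x \<in> S" for x
  proof -
    have "(g has_derivative (\<lambda>h. jacobian g (at x) *v h)) (at x)"
      using C1(1) that g(2) jacobian_works by blast
    then show ?thesis
      unfolding J[OF that] using has_derivative_transform_within_open assms(1) that g(4) by blast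
  qed
  have "continuous_on S (\<lambda>x. jacobian g (at x))"
  proof (cases "S = {}")
    case False
    then have "continuous_on S (\<lambda>x. frechet_derivative g (at x) v)" for v
      using C1(2) g(2) continuous_on_subset by blast
    then show ?thesis
      unfolding jacobian_def matrix_def by (intro continuous_on_vec_lambda continuous_intros)
  qed simp
  then show "continuous_on S (\<lambda>x. jacobian f (at x))"
    using J continuous_on_cong by force
qed

lemma smooth_on_id: "smooth_on S (\<lambda>x. x)"
proof -
  have const: "Ck_on k UNIV (\<lambda>x::'a. c::'a)" for k c
    by (induction k arbitrary: c) (auto simp: frechet_derivative_const)
  have "Ck_on k UNIV (\<lambda>x::'a. x)" for k
    by (cases k) (auto simp: const frechet_derivative_ident)
  then show ?thesis
    unfolding smooth_on_def by (intro exI[of _ UNIV] exI[of _ "\<lambda>x. x"]) auto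
qed

lemma smooth_on_cong:
  assumes "smooth_on S f" "\<And>x. x \<in> S \<Longrightarrow> f x = g x"
  shows "smooth_on S g"
  using assms unfolding smooth_on_def by metis

lemma continuous_on_det [continuous_intros]:
  fixes A :: "'a::topological_space \<Rightarrow> real^'n^'n"
  assumes "continuous_on S A"
  shows "continuous_on S (\<lambda>x. det (A x))"
  unfolding det_def by (intro continuous_intros assms)

section \<open>Diffeomorphisms of a model domain and the volume functional\<close>

text \<open>
  By invariance of domain, the image of \<open>\<Omega>\<close> is open. It lies in the closure of \<open>\<Omega>\<close>, hence in the
  interior of this closure, which is \<open>\<Omega>\<close>. For a slit domain this would fail: the map might move the
  slit into the domain.
\<close>

lemma continuous_bij_closure_maps_domain_into:
  fixes \<Omega> :: "'a::euclidean_space set"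
  assumes "open \<Omega>" "interior (closure \<Omega>) = \<Omega>"
    and "bij_betw \<Phi> (closure \<Omega>) (closure \<Omega>)" "continuous_on (closure \<Omega>) \<Phi>"
  shows "\<Phi> ` \<Omega> \<subseteq> \<Omega>"
proof -
  have "open (\<Phi> ` \<Omega>)"
    using assms closure_subset[of \<Omega>]
    by (intro invariance_of_domain) (auto intro: continuous_on_subset inj_on_subset simp: bij_betw_def)
  moreover have "\<Phi> ` \<Omega> \<subseteq> closure \<Omega>"
    using assms(3) closure_subset[of \<Omega>] by (auto simp: bij_betw_def)
  ultimately show ?thesis
    using interior_maximal assms(2) by metis
qed

text \<open>
  Both a diffeomorphism of the closure and its inverse map \<open>\<Omega>\<close> into itself, so the inverse is a
  smooth bijection of \<open>\<Omega>\<close> and can serve as a change of variables there.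
\<close>

lemma diffeos_inverse_maps_domain:
  assumes "model_domain \<Omega>" "\<Phi> \<in> diffeos \<Omega>"
  defines "\<Psi> \<equiv> inv_into (closure \<Omega>) \<Phi>"
  shows "smooth_on \<Omega> \<Psi>" "inj_on \<Psi> \<Omega>" "\<Psi> ` \<Omega> = \<Omega>"
proof -
  have \<Omega>: "open \<Omega>" "interior (closure \<Omega>) = \<Omega>"
    using assms(1) by (auto simp: model_domain_def)
  have \<Phi>: "bij_betw \<Phi> (closure \<Omega>) (closure \<Omega>)" "smooth_on (closure \<Omega>) \<Phi>"
      "smooth_on (closure \<Omega>) \<Psi>"
    using assms(2) by (auto simp: diffeos_def \<Psi>_def)
  have \<Psi>: "bij_betw \<Psi> (closure \<Omega>) (closure \<Omega>)"
    unfolding \<Psi>_def by (rule bij_betw_inv_into[OF \<Phi>(1)])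
  show "smooth_on \<Omega> \<Psi>"
    using \<Phi>(3) closure_subset by (rule smooth_on_subset)
  show "inj_on \<Psi> \<Omega>"
    using \<Psi> closure_subset by (auto simp: bij_betw_def intro: inj_on_subset)
  have "\<Phi> ` \<Omega> \<subseteq> \<Omega>" "\<Psi> ` \<Omega> \<subseteq> \<Omega>"
    using continuous_bij_closure_maps_domain_into[OF \<Omega>] \<Phi> \<Psi> smooth_on_imp_continuous_on
    by blast+
  moreover have "\<Psi> (\<Phi> x) = x" if "x \<in> \<Omega>" for x
    using bij_betw_inv_into_left[OF \<Phi>(1)] that closure_subset unfolding \<Psi>_def by blast
  ultimately show "\<Psi> ` \<Omega> = \<Omega>"
    by (force simp: image_iff)
qed

text \<open>
  The Jacobian determinant of the inverse enters the Gram determinant squared, and its absolute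
  value after the square root is the density in the change of variables formula.
\<close>

lemma V_N_reparam:
  fixes u :: "real^'n \<Rightarrow> real^'m"
  assumes \<Omega>: "model_domain \<Omega>" and \<Phi>: "\<Phi> \<in> diffeos \<Omega>" and u: "feasible \<Omega> u"
  shows "V_N \<Omega> (reparam \<Omega> \<Phi> u) = V_N \<Omega> u"
proof -
  define \<Psi> where "\<Psi> = inv_into (closure \<Omega>) \<Phi>"
  define v where "v y = sqrt (det (transpose (jacobian u (at y)) ** jacobian u (at y)))" for y
  let ?J = "\<lambda>x. jacobian \<Psi> (at x)"
  have op: "open \<Omega>"
    using \<Omega> by (simp add: model_domain_def)
  note \<Psi> = diffeos_inverse_maps_domain[OF \<Omega> \<Phi>, folded \<Psi>_def]
  have su: "smooth_on \<Omega> u"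
    using u by (simp add: feasible_def)
  note Du = smooth_on_imp_has_derivative_jacobian[OF op su]
  note D\<Psi> = smooth_on_imp_has_derivative_jacobian[OF op \<Psi>(1)]
  have chain: "jacobian (reparam \<Omega> \<Phi> u) (at x) = jacobian u (at (\<Psi> x)) ** ?J x" if "x \<in> \<Omega>" for x
  proof (rule jacobian_eqI)
    have "\<Psi> x \<in> \<Omega>"
      using \<Psi>(3) that by blast
    from diff_chain_at[OF D\<Psi>[OF that] Du[OF this]]
    show "(reparam \<Omega> \<Phi> u has_derivative (\<lambda>h. (jacobian u (at (\<Psi> x)) ** ?J x) *v h)) (at x)"
      by (simp add: reparam_def \<Psi>_def o_def matrix_vector_mul_assoc)
  qed
  have dens: "sqrt (det (transpose (jacobian (reparam \<Omega> \<Phi> u) (at x)) **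
      jacobian (reparam \<Omega> \<Phi> u) (at x))) = \<bar>det (?J x)\<bar> * v (\<Psi> x)" if "x \<in> \<Omega>" for x
  proof -
    let ?A = "jacobian u (at (\<Psi> x))"
    have "transpose (?A ** ?J x) ** (?A ** ?J x) = transpose (?J x) ** (transpose ?A ** ?A) ** ?J x"
      by (simp add: matrix_transpose_mul matrix_mul_assoc)
    then have "det (transpose (?A ** ?J x) ** (?A ** ?J x)) =
        (det (?J x))\<^sup>2 * det (transpose ?A ** ?A)"
      by (simp only: det_mul det_transpose power2_eq_square mult_ac)
    then show ?thesis
      unfolding chain[OF that] v_def by (simp only: real_sqrt_mult real_sqrt_abs)
  qed
  have cv: "continuous_on \<Omega> v"
    unfolding v_def matrix_matrix_mult_def transpose_def
    by (intro continuous_intros continuous_on_vec_lambda smooth_on_imp_continuous_on_jacobian[OF op su])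
  have cJ: "continuous_on \<Omega> (\<lambda>x. \<bar>det (?J x)\<bar> * v (\<Psi> x))"
    using smooth_on_imp_continuous_on_jacobian[OF op \<Psi>(1)]
      continuous_on_compose2[OF cv smooth_on_imp_continuous_on[OF \<Psi>(1)]] \<Psi>(3)
    by (intro continuous_intros) auto
  have "V_N \<Omega> (reparam \<Omega> \<Phi> u) = (\<integral>\<^sup>+x\<in>\<Omega>. ennreal (\<bar>det (?J x)\<bar> * v (\<Psi> x)) \<partial>lborel)"
    unfolding V_N_def by (intro nn_integral_cong) (auto simp: dens split: split_indicator)
  also have "\<dots> = (\<integral>\<^sup>+x\<in>\<Omega>. ennreal (\<bar>det (matrix (\<lambda>h. ?J x *v h))\<bar> * v (\<Psi> x)) \<partial>lborel)"
    by (simp only: matrix_of_matrix_vector_mul)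
  also have "\<dots> = (\<integral>\<^sup>+y\<in>\<Psi> ` \<Omega>. ennreal (v y) \<partial>lborel)"
  proof (rule nn_integral_change_of_variables)
    show "(\<Psi> has_derivative (\<lambda>h. ?J x *v h)) (at x within \<Omega>)" if "x \<in> \<Omega>" for x
      using D\<Psi>[OF that] by (rule has_derivative_at_withinI)
    show "0 \<le> v y" if "y \<in> \<Psi> ` \<Omega>" for y
      by (simp add: v_def gram_matrix_columns det_gram_nonneg)
    show "set_borel_measurable borel \<Omega> (\<lambda>x. \<bar>det (matrix (\<lambda>h. ?J x *v h))\<bar> * v (\<Psi> x))"
      using borel_measurable_continuous_on_indicator[OF _ cJ] op
      by (simp add: set_borel_measurable_def)
    show "set_borel_measurable borel (\<Psi> ` \<Omega>) v"
      using borel_measurable_continuous_on_indicator[OF _ cv] op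
      by (simp add: set_borel_measurable_def \<Psi>(3))
  qed (use op \<Psi>(2) in auto)
  also have "\<dots> = V_N \<Omega> u"
    unfolding \<Psi>(3) V_N_def v_def ..
  finally show ?thesis .
qed

section \<open>Comparison of the functionals\<close>

lemma V_N_le_I_N: "V_N \<Omega> u \<le> I_N \<Omega> u"
  unfolding V_N_def I_N_def
  by (intro nn_integral_mono mult_right_mono ennreal_leI volume_density_le_energy_density) auto

lemma identity_in_diffeos_id:
  assumes "open \<Omega>"
  shows "restrict (\<lambda>x. x) (closure \<Omega>) \<in> diffeos_id \<Omega>"
proof -
  let ?I = "restrict (\<lambda>x. x) (closure \<Omega>)"
  have bij: "bij_betw ?I (closure \<Omega>) (closure \<Omega>)"
    by (simp add: bij_betw_def inj_on_def)
  have inv: "inv_into (closure \<Omega>) ?I x = x" if "x \<in> closure \<Omega>" for x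
    using bij_betw_inv_into_left[OF bij that] that by simp
  have "jacobian ?I (at x) = mat 1" if "x \<in> \<Omega>" for x
  proof -
    have "jacobian ?I (at x) = jacobian (\<lambda>x. x) (at x)"
      using closure_subset by (intro jacobian_cong_open[OF assms that]) auto
    also have "\<dots> = mat 1"
      by (rule jacobian_eqI) simp
    finally show ?thesis .
  qed
  then show ?thesis
    using bij inv frontier_def[of \<Omega>]
    by (auto simp: diffeos_id_def diffeos_def intro!: smooth_on_cong[OF smooth_on_id])
qed

lemma I_N_reparam_identity:
  assumes "open \<Omega>"
  shows "I_N \<Omega> (reparam \<Omega> (restrict (\<lambda>x. x) (closure \<Omega>)) u) = I_N \<Omega> u"
proof -
  let ?I = "restrict (\<lambda>x. x) (closure \<Omega>)"
  have "inv_into (closure \<Omega>) ?I x = x" if "x \<in> \<Omega>" for x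
    using inv_into_f_f[of ?I "closure \<Omega>" x] closure_subset[of \<Omega>] that
    by (auto simp: inj_on_def)
  then have "jacobian (reparam \<Omega> ?I u) (at x) = jacobian u (at x)" if "x \<in> \<Omega>" for x
    by (intro jacobian_cong_open[OF assms that]) (simp add: reparam_def)
  then show ?thesis
    unfolding I_N_def by (intro nn_integral_cong) (auto split: split_indicator)
qed

theorem corollary6p2:
  fixes \<Omega> :: "(real^'n) set" and D0 :: "(real^'n \<Rightarrow> real^'n) set"
  assumes "CARD('m) > CARD('n)"
    and "model_domain \<Omega>"
    and "invariant_class \<Omega> D0"
  shows "invariant_under \<Omega> D0 (V_N \<Omega> :: (real^'n \<Rightarrow> real^'m) \<Rightarrow> ennreal) \<and>
    (\<forall>u :: real^'n \<Rightarrow> real^'m. feasible \<Omega> u \<longrightarrow>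
       V_N \<Omega> u \<le> invariant_realization \<Omega> D0 (I_N \<Omega>) u \<and>
       invariant_realization \<Omega> D0 (I_N \<Omega>) u \<le> I_N \<Omega> u)"
proof -
  let ?I = "restrict (\<lambda>x. x) (closure \<Omega>)"
  have D0: "D0 \<subseteq> diffeos \<Omega>" "diffeos_id \<Omega> \<subseteq> D0"
    using assms(3) by (auto simp: invariant_class_def)
  have "open \<Omega>"
    using assms(2) by (simp add: model_domain_def)
  have inv: "V_N \<Omega> (reparam \<Omega> \<Phi> u) = V_N \<Omega> u" if "feasible \<Omega> u" "\<Phi> \<in> D0"
    for u :: "real^'n \<Rightarrow> real^'m" and \<Phi>
    using V_N_reparam[OF assms(2) _ that(1)] that(2) D0(1) by blast
  have lower: "V_N \<Omega> u \<le> invariant_realization \<Omega> D0 (I_N \<Omega>) u" if "feasible \<Omega> u"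
    for u :: "real^'n \<Rightarrow> real^'m"
    unfolding invariant_realization_def
  proof (rule INF_greatest)
    fix \<Phi> assume "\<Phi> \<in> D0"
    then have "V_N \<Omega> u = V_N \<Omega> (reparam \<Omega> \<Phi> u)"
      using inv that by simp
    also have "\<dots> \<le> I_N \<Omega> (reparam \<Omega> \<Phi> u)"
      by (rule V_N_le_I_N)
    finally show "V_N \<Omega> u \<le> I_N \<Omega> (reparam \<Omega> \<Phi> u)" .
  qed
  have upper: "invariant_realization \<Omega> D0 (I_N \<Omega>) u \<le> I_N \<Omega> u" for u :: "real^'n \<Rightarrow> real^'m"
  proof -
    have "?I \<in> D0"
      using identity_in_diffeos_id[OF \<open>open \<Omega>\<close>] D0(2) by blast
    then have "invariant_realization \<Omega> D0 (I_N \<Omega>) u \<le> I_N \<Omega> (reparam \<Omega> ?I u)"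
      unfolding invariant_realization_def by (rule INF_lower)
    then show ?thesis
      by (simp only: I_N_reparam_identity[OF \<open>open \<Omega>\<close>])
  qed
  show ?thesis
    using inv lower upper by (simp add: invariant_under_def)
qed

end
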